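(* Let $\beta > 1$ be a Pisot number and let $\alpha \in [0,1)$ be normal to base $\beta$. Then the sequence $(\{\beta^n \alpha\})_{n \geq 1}$ does not have non-trivial bounded remainder sets; that is, no interval $[a,b) \subseteq [0,1)$ other than the empty set and $[0,1)$ itself is a bounded remainder set for this sequence.
   Context: $\{x\}$ denotes the fractional part of $x$. Bounded remainder set (BRS): let $(x_n)_{n\ge 1}$ be a sequence in $[0,1)$ and $[a,b)\subseteq[0,1)$. For $N\in\mathbb{N}=\{1,2,\dots\}$ put $D_N([a,b)) = \frac1N\left(\#\{1\le n\le N: x_n\in[a,b)\} - N(b-a)\right)$. The interval $[a,b)$ is a BRS for $(x_n)_{n\geq 1}$ if there is a constant $c$ (independent of $N$) such that $|D_N([a,b))|\le c\,\frac1N$ for all $N\in\mathbb{N}$. The empty set and $[0,1)$ are the trivial BRS. A Pisot number is a real algebraic integer $\beta>1$ all of whose other conjugates have absolute value less than $1$ (in particular every integer $\beta>1$ is a Pisot number). The $\beta$-expansion of $\alpha\in[0,1)$ is the expansion $\alpha=\sum_{i=1}^\infty \alpha_i\beta^{-i}$ with digits $\alpha_i\in\{0,1,\dots,\lceil\beta\rceil-1\}$ such that $\sum_{i>j}\alpha_i\beta^{-i}<\beta^{-j}$ for all $j\ge 0$. The number $\alpha$ is normal to base $\beta$ if every admissible finite block $d=d_1\cdots d_k$ of digits (i.e. every block occurring in the $\beta$-expansion of some number in $[0,1)$) occurs in the $\beta$-expansion of $\alpha$ with the right asymptotic frequency, namely $\mu_\beta(\{x\in[0,1): \text{the }\beta\text{-expansion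 of }x\text{ begins with }d\})$, where $\mu_\beta$ is the unique absolutely continuous probability measure on $[0,1)$ invariant under $x\mapsto\{\beta x\}$. *)

theory Defs
  imports "HOL-Probability.Probability" "HOL-Computational_Algebra.Computational_Algebra"
begin

definition discrepancy :: "(nat \<Rightarrow> real) \<Rightarrow> real \<Rightarrow> real \<Rightarrow> nat \<Rightarrow> real" where
  "discrepancy x a b N =
     1 / real N * (real (card {n \<in> {1..N}. x n \<in> {a..<b}}) - real N * (b - a))"

definition bounded_remainder_set :: "(nat \<Rightarrow> real) \<Rightarrow> real \<Rightarrow> real \<Rightarrow> bool" where
  "bounded_remainder_set x a b \<longleftrightarrow>
     (\<exists>c. \<forall>N\<ge>1. \<bar>discrepancy x a b N\<bar> \<le> c * (1 / real N))"

text \<open>The conjugates of an algebraic number are the complex roots of its minimal polynomial over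
  the rationals, i.e. of any irreducible rational polynomial that it is a root of.\<close>

definition conjugate_of :: "complex \<Rightarrow> complex \<Rightarrow> bool" where
  "conjugate_of x z \<longleftrightarrow>
     (\<exists>p :: rat poly. irreducible p \<and> poly (map_poly of_rat p) x = 0 \<and> poly (map_poly of_rat p) z = 0)"

definition pisot_number :: "real \<Rightarrow> bool" where
  "pisot_number \<beta> \<longleftrightarrow> algebraic_int \<beta> \<and> \<beta> > 1 \<and>
     (\<forall>z. conjugate_of (of_real \<beta>) z \<longrightarrow> z \<noteq> of_real \<beta> \<longrightarrow> norm z < 1)"

text \<open>Digit sequences are indexed from 0: \<open>d i\<close> is the coefficient of
  \<open>1 / \<beta> ^ (i + 1)\<close>.\<close>

definition is_beta_expansion :: "real \<Rightarrow> real \<Rightarrow> (nat \<Rightarrow> nat) \<Rightarrow> bool" where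
  "is_beta_expansion \<beta> x d \<longleftrightarrow>
     (\<forall>i. int (d i) \<in> {0..\<lceil>\<beta>\<rceil> - 1}) \<and>
     (\<lambda>i. real (d i) / \<beta> ^ (i + 1)) sums x \<and>
     (\<forall>j. (\<Sum>i. real (d (i + j)) / \<beta> ^ (i + j + 1)) < 1 / \<beta> ^ j)"

definition beta_expansion :: "real \<Rightarrow> real \<Rightarrow> nat \<Rightarrow> nat" where
  "beta_expansion \<beta> x = (THE d. is_beta_expansion \<beta> x d)"

lemma summable_digits:
  assumes "\<beta> > 1" "\<And>i. int (d i) \<in> {0..\<lceil>\<beta>\<rceil> - 1}"
  shows "summable (\<lambda>i. real (d (i + j)) / \<beta> ^ (i + k))"
proof (rule summable_comparison_test')
  have "summable (\<lambda>i. real_of_int \<lceil>\<beta>\<rceil> / \<beta> ^ k * (1 / \<beta>) ^ i)"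
    using assms(1) by (intro summable_mult summable_geometric) auto
  thus "summable (\<lambda>i. real_of_int \<lceil>\<beta>\<rceil> / \<beta> ^ (i + k))"
    by (simp add: field_simps power_add)
  fix i :: nat
  have "real (d (i + j)) \<le> real_of_int \<lceil>\<beta>\<rceil>"
    using assms(2)[of "i + j"] by simp
  thus "norm (real (d (i + j)) / \<beta> ^ (i + k)) \<le> real_of_int \<lceil>\<beta>\<rceil> / \<beta> ^ (i + k)"
    using assms(1) by (simp add: divide_right_mono)
qed

lemma is_beta_expansion_unique:
  assumes "\<beta> > 1" "is_beta_expansion \<beta> x d"
  shows "d j = nat \<lfloor>\<beta> * ((\<lambda>y. frac (\<beta> * y)) ^^ j) x\<rfloor>"
proof -
  define r where "r j = (\<Sum>i. real (d (i + j)) / \<beta> ^ (i + 1))" for j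
  have dig: "\<And>i. int (d i) \<in> {0..\<lceil>\<beta>\<rceil> - 1}"
    using assms(2) by (simp add: is_beta_expansion_def)
  have sm: "summable (\<lambda>i. real (d (i + j)) / \<beta> ^ (i + k))" for j k
    using summable_digits[where d = d] assms(1) dig by blast
  have r0: "r j \<ge> 0" for j
    unfolding r_def using sm[of j 1] assms(1) by (intro suminf_nonneg) auto
  have r1: "r j < 1" for j
  proof -
    have "(\<Sum>i. real (d (i + j)) / \<beta> ^ (i + j + 1)) = (\<Sum>i. (real (d (i + j)) / \<beta> ^ (i + 1)) / \<beta> ^ j)"
      by (simp add: power_add field_simps)
    also have "\<dots> = r j / \<beta> ^ j"
      unfolding r_def using sm[of j 1] by (intro suminf_divide) simp
    finally have "r j / \<beta> ^ j < 1 / \<beta> ^ j"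
      using assms(2) unfolding is_beta_expansion_def by metis
    thus ?thesis using assms(1) by (simp add: divide_less_cancel)
  qed
  have step: "\<beta> * r j = real (d j) + r (Suc j)" for j
  proof -
    have "\<beta> * r j = (\<Sum>i. \<beta> * (real (d (i + j)) / \<beta> ^ (i + 1)))"
      unfolding r_def using sm[of j 1] by (intro suminf_mult[symmetric]) simp
    also have "\<dots> = (\<Sum>i. real (d (i + j)) / \<beta> ^ i)"
      using assms(1) by simp
    also have "\<dots> = (\<Sum>i. real (d (Suc i + j)) / \<beta> ^ Suc i) + real (d j)"
      using suminf_split_head[OF sm[of j 0, simplified]] by simp
    finally show ?thesis by (simp add: r_def)
  qed
  have fl: "\<lfloor>\<beta> * r j\<rfloor> = int (d j)" for j
    unfolding step using r0[of "Suc j"] r1[of "Suc j"] by (intro floor_unique) auto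
  have "r j = ((\<lambda>y. frac (\<beta> * y)) ^^ j) x"
  proof (induction j)
    case 0
    show ?case
      using assms(2) by (simp add: r_def is_beta_expansion_def sums_iff)
  next
    case (Suc j)
    have "frac (\<beta> * r j) = r (Suc j)"
      unfolding frac_def fl by (simp add: step)
    with Suc show ?case by simp
  qed
  thus ?thesis using fl[of j] by simp
qed

lemma is_beta_expansion_exists:
  assumes "\<beta> > 1" "x \<in> {0..<1}"
  shows "is_beta_expansion \<beta> x (\<lambda>j. nat \<lfloor>\<beta> * ((\<lambda>y. frac (\<beta> * y)) ^^ j) x\<rfloor>)"
proof -
  define t where "t j = ((\<lambda>y. frac (\<beta> * y)) ^^ j) x" for j
  define d where "d j = nat \<lfloor>\<beta> * t j\<rfloor>" for j
  have t: "0 \<le> t j" "t j < 1" for j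
    using assms(2) by (cases j; simp add: t_def frac_lt_1)+
  have d: "real (d j) = \<beta> * t j - t (Suc j)" for j
  proof -
    have "\<lfloor>\<beta> * t j\<rfloor> \<ge> 0" using t[of j] assms(1) by simp
    moreover have "t (Suc j) = frac (\<beta> * t j)" by (simp add: t_def)
    ultimately show ?thesis by (simp add: d_def frac_def)
  qed
  have dig: "int (d i) \<in> {0..\<lceil>\<beta>\<rceil> - 1}" for i
  proof -
    have "\<beta> * t i < \<beta> * 1"
      using t[of i] assms(1) by (intro mult_strict_left_mono) auto
    hence "real (d i) < \<beta>" using d[of i] t(1)[of "Suc i"] by simp
    hence "int (d i) < \<lceil>\<beta>\<rceil>" by (simp add: less_ceiling_iff)
    thus ?thesis by simp
  qed
  have partial: "(\<Sum>i<n. real (d (i + j)) / \<beta> ^ (i + j + 1)) = t j / \<beta> ^ j - t (j + n) / \<beta> ^ (j + n)"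
    for n j
  proof (induction n)
    case (Suc n)
    have "real (d (n + j)) / \<beta> ^ (n + j + 1) = t (j + n) / \<beta> ^ (j + n) - t (j + Suc n) / \<beta> ^ (j + Suc n)"
      using assms(1) by (simp add: d field_simps add.commute)
    with Suc show ?case by simp
  qed simp
  have lim: "(\<lambda>n. t (j + n) / \<beta> ^ (j + n)) \<longlonglongrightarrow> 0" for j
  proof (rule tendsto_sandwich[of "\<lambda>_. 0" _ _ "\<lambda>n. (1 / \<beta>) ^ n"])
    show "(\<lambda>n. (1 / \<beta>) ^ n) \<longlonglongrightarrow> 0"
      using assms(1) by (intro LIMSEQ_power_zero) auto
    have "t (j + n) / \<beta> ^ (j + n) \<le> (1 / \<beta>) ^ n" for n
    proof -
      have "t (j + n) / \<beta> ^ (j + n) \<le> 1 / \<beta> ^ n"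
        using t[of "j + n"] assms(1) by (intro frac_le) (auto intro: power_increasing)
      thus ?thesis by (simp add: power_one_over)
    qed
    thus "\<forall>\<^sub>F n in sequentially. t (j + n) / \<beta> ^ (j + n) \<le> (1 / \<beta>) ^ n"
      by simp
  qed (use t assms(1) in auto)
  have sums: "(\<lambda>i. real (d (i + j)) / \<beta> ^ (i + j + 1)) sums (t j / \<beta> ^ j)" for j
    unfolding sums_def partial using tendsto_diff[OF tendsto_const lim] by simp
  have "is_beta_expansion \<beta> x d"
    unfolding is_beta_expansion_def
  proof (intro conjI allI)
    show "(\<lambda>i. real (d i) / \<beta> ^ (i + 1)) sums x"
      using sums[of 0] by (simp add: t_def)
    fix j
    show "(\<Sum>i. real (d (i + j)) / \<beta> ^ (i + j + 1)) < 1 / \<beta> ^ j"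
      unfolding sums_unique[OF sums[of j], symmetric]
      using t[of j] assms(1) by (intro divide_strict_right_mono) auto
  qed (rule dig)
  thus ?thesis by (simp add: d_def[abs_def] t_def)
qed

lemma is_beta_expansion_ex1:
  assumes "\<beta> > 1" "x \<in> {0..<1}"
  shows "\<exists>!d. is_beta_expansion \<beta> x d"
proof (rule ex1I)
  show "is_beta_expansion \<beta> x (\<lambda>j. nat \<lfloor>\<beta> * ((\<lambda>y. frac (\<beta> * y)) ^^ j) x\<rfloor>)"
    by (rule is_beta_expansion_exists[OF assms])
qed (use is_beta_expansion_unique[OF assms(1)] in auto)

lemma is_beta_expansion_beta_expansion:
  assumes "\<beta> > 1" "x \<in> {0..<1}"
  shows "is_beta_expansion \<beta> x (beta_expansion \<beta> x)"
  unfolding beta_expansion_def by (rule theI'[OF is_beta_expansion_ex1[OF assms]])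

definition occurs_at :: "nat list \<Rightarrow> (nat \<Rightarrow> nat) \<Rightarrow> nat \<Rightarrow> bool" where
  "occurs_at w d n \<longleftrightarrow> (\<forall>k<length w. d (n + k) = w ! k)"

definition admissible_block :: "real \<Rightarrow> nat list \<Rightarrow> bool" where
  "admissible_block \<beta> w \<longleftrightarrow> (\<exists>x\<in>{0..<1}. \<exists>n. occurs_at w (beta_expansion \<beta> x) n)"

definition beta_invariant_measure :: "real \<Rightarrow> real measure \<Rightarrow> bool" where
  "beta_invariant_measure \<beta> \<mu> \<longleftrightarrow>
     prob_space \<mu> \<and>
     sets \<mu> = sets (restrict_space borel {0..<1}) \<and>
     absolutely_continuous (restrict_space lborel {0..<1}) \<mu> \<and>
     distr \<mu> \<mu> (\<lambda>x. frac (\<beta> * x)) = \<mu>"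

text \<open>For \<open>\<beta> > 1\<close> there is exactly one measure \<open>\<mu>\<close> with
  \<open>beta_invariant_measure \<beta> \<mu>\<close> (Renyi, Parry), so the quantifier over \<open>\<mu>\<close> below merely names it.\<close>

definition normal_to_base :: "real \<Rightarrow> real \<Rightarrow> bool" where
  "normal_to_base \<beta> \<alpha> \<longleftrightarrow>
     (\<exists>\<mu>. beta_invariant_measure \<beta> \<mu> \<and>
       (\<forall>w. admissible_block \<beta> w \<longrightarrow>
         (\<lambda>N. real (card {n \<in> {..<N}. occurs_at w (beta_expansion \<beta> \<alpha>) n}) / real N)
           \<longlonglongrightarrow> measure \<mu> {x \<in> {0..<1}. occurs_at w (beta_expansion \<beta> x) 0}))"

end

theory Submission
  imports Defs "Berlekamp_Zassenhaus.Factor_Bound"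
begin

text \<open>
Write \<open>T x = frac (\<beta> * x)\<close> and \<open>r n\<close> for the \<open>n\<close>-th iterate of \<open>T\<close> at \<open>\<alpha>\<close>. The whole proof rests
on long blocks of zero digits, during which \<open>frac (\<beta> ^ n * \<alpha>)\<close> stays just above 0.

If \<open>frac (\<beta> ^ n * \<alpha>)\<close> lies in \<open>[0, \<epsilon>)\<close> for \<open>W\<close> consecutive indices, with \<open>\<epsilon>\<close> small, then all of these
points lie in \<open>[0, b)\<close> and none of them in \<open>[a, b)\<close> with \<open>a > 0\<close>. So over this window the counting error
of \<open>[a, b)\<close> changes by \<open>W * (1 - b)\<close> if \<open>a = 0\<close> and by \<open>- W * (b - a)\<close> if \<open>a > 0\<close>. As \<open>W\<close> can be
arbitrarily large (\<open>orbit_near_zero_window\<close>), a bounded error is impossible unless \<open>[a, b)\<close> is trivial.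

For an integer \<open>\<beta>\<close> the point \<open>frac (\<beta> ^ n * \<alpha>)\<close> is \<open>r n\<close>, and a zero block keeps it close to 0. For a
general Pisot number the digits \<open>d 0, ..., d (n - 1)\<close> that have already been shifted out also
contribute, since \<open>\<beta> ^ n * \<alpha> = (\<Sum>i<n. d i * \<beta> ^ (n - 1 - i)) + r n\<close>. Adding to \<open>\<beta> ^ k\<close> the \<open>k\<close>-th powers
of the other conjugates gives the trace of \<open>\<beta> ^ k\<close>, an integer, and these powers decay like
\<open>\<rho> ^ k\<close> with \<open>\<rho> < 1\<close> (\<open>pisot_near_integer_powers\<close>). So modulo 1 the past contributes a sum \<open>p n\<close>
that decays geometrically along a zero block, and \<open>frac (\<beta> ^ n * \<alpha>) = frac (r n - p n)\<close>. It matters on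
which side of 0 the difference lies. If a nonzero digit ends the zero block, then \<open>r n\<close> is
comparable to \<open>1 / \<beta> ^ k\<close> at distance \<open>k\<close> from that digit; hence for bounded \<open>k\<close> and a sufficiently long
block it dominates \<open>p n\<close>, and the difference is positive.

It remains to find long zero blocks that end (\<open>normal_long_zero_run\<close>). By normality a zero block of
length \<open>L\<close> has frequency \<open>\<mu> [0, 1 / \<beta> ^ L)\<close>, where \<open>\<mu>\<close> is the invariant measure. This is positive: otherwise
almost every orbit avoids \<open>[0, 1 / \<beta> ^ L)\<close>, but a forward invariant set that avoids a neighbourhood of 0 is
Lebesgue null (\<open>forward_invariant_null\<close>), hence \<open>\<mu>\<close>-null. If on the other hand the digits were
eventually 0, then \<open>\<mu> [0, 1 / \<beta> ^ L) = 1\<close> for all \<open>L\<close>, so that \<open>\<mu>\<close> would be concentrated at 0.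
\<close>

section \<open>Powers of a Pisot number are nearly integers\<close>

text \<open>Gauss's lemma: an irreducible integer factor of a monic integer polynomial is monic up to sign,
  hence primitive, and so it stays irreducible over the rationals.\<close>

lemma algebraic_int_minimal_polynomial:
  fixes x :: complex
  assumes "algebraic_int x"
  obtains Q :: "int poly" where "lead_coeff Q = 1" "irreducible (map_poly rat_of_int Q)"
    "poly (map_poly of_int Q) x = 0"
proof -
  obtain P :: "int poly" where P: "poly (map_poly of_int P) x = 0" "lead_coeff P = 1"
    using assms by (auto simp: algebraic_int_altdef_ipoly)
  have P0: "P \<noteq> 0" using P(2) by auto
  obtain A where A: "\<And>q. q \<in># A \<Longrightarrow> prime q" "normalize (prod_mset A) = normalize P"
    using prime_factorization_exists'[OF P0] by blast
  have "P dvd prod_mset A" using A(2) by (metis associatedD1)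
  then obtain k where k: "prod_mset A = P * k" by (elim dvdE)
  have "poly (map_poly of_int (prod_mset A)) x = 0"
    unfolding k by (simp add: of_int_poly_hom.hom_mult P(1))
  hence "\<exists>q\<in>#A. poly (map_poly of_int q) x = 0"
    by (induction A) (auto simp: of_int_poly_hom.hom_mult)
  then obtain q where q: "q \<in># A" "poly (map_poly of_int q) x = 0" by blast
  have irr: "irreducible q" using A(1)[OF q(1)] by (intro prime_elem_imp_irreducible) auto
  have "q dvd P"
    using A(2) q(1) by (metis dvd_prod_mset dvd_normalize_iff)
  then obtain r where r: "P = q * r" by (elim dvdE)
  have lc: "lead_coeff q * lead_coeff r = 1"
    using P(2) unfolding r by (simp add: lead_coeff_mult)
  hence lc': "lead_coeff q = 1 \<or> lead_coeff q = -1"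
    using pos_zmult_eq_1_iff_lemma by blast
  have "lead_coeff q \<in> set (coeffs q)"
    using lc' by (intro coeff_in_coeffs) auto
  hence "primitive q" using lc' unfolding primitive_def by (metis dvd_minus_iff)
  hence "irreducible\<^sub>d q" using irr irreducible_primitive_connect by blast
  hence "irreducible\<^sub>d (map_poly rat_of_int q)" by (rule irreducible\<^sub>d_int_rat)
  hence irr': "irreducible (map_poly rat_of_int q)" by simp
  show ?thesis
  proof (cases "lead_coeff q = 1")
    case True
    thus ?thesis using that irr' q(2) by blast
  next
    case False
    hence "lead_coeff (-q) = 1" using lc' by simp
    moreover have "map_poly rat_of_int (-q) = Polynomial.smult (-1) (map_poly rat_of_int q)"
      by (simp add: hom_distribs)
    hence "irreducible (map_poly rat_of_int (-q))" using irr' by simp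
    moreover have "poly (map_poly of_int (-q)) x = 0"
      using q(2) by (simp add: hom_distribs)
    ultimately show ?thesis using that by blast
  qed
qed

text \<open>By degree \<open>p\<close> does not divide \<open>pderiv p\<close>, so the two are coprime, and a Bezout identity excludes a
  common complex root. This is why \<open>\<beta>\<close> is counted only once in the sum of the powers of all roots.\<close>

lemma irreducible_rat_poly_rsquarefree:
  fixes p :: "rat poly"
  assumes "irreducible p"
  shows "rsquarefree (map_poly of_rat p :: complex poly)"
  unfolding rsquarefree_roots
proof (intro allI notI, elim conjE)
  fix z :: complex
  let ?h = "map_poly of_rat :: rat poly \<Rightarrow> complex poly"
  assume z: "poly (?h p) z = 0" "poly (pderiv (?h p)) z = 0"
  interpret map_poly_comm_ring_hom "of_rat :: rat \<Rightarrow> complex" ..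
  have "degree p \<noteq> 0"
    using assms by (metis irreducible_connect_field irreducible\<^sub>dD(1) less_irrefl)
  hence "pderiv p \<noteq> 0" by (simp add: pderiv_eq_0_iff)
  hence "\<not> p dvd pderiv p"
    using dvd_imp_degree_le[of p "pderiv p"] degree_pderiv[of p] \<open>degree p \<noteq> 0\<close> by auto
  hence "coprime p (pderiv p)"
    using assms by (simp add: prime_elem_imp_coprime irreducible_imp_prime_elem)
  moreover define u v where "u = fst (bezout_coefficients p (pderiv p))"
    and "v = snd (bezout_coefficients p (pderiv p))"
  ultimately have "u * p + v * pderiv p = 1"
    using bezout_coefficients_fst_snd[of p "pderiv p"] by simp
  hence "?h (u * p + v * pderiv p) = 1" by simp
  hence "?h u * ?h p + ?h v * pderiv (?h p) = 1"
    by (simp add: hom_add hom_mult of_rat_hom.map_poly_pderiv)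
  hence "poly (?h u * ?h p + ?h v * pderiv (?h p)) z = 1" by simp
  thus False using z by simp
qed

text \<open>Newton's identities between the power sums and the elementary symmetric functions of \<open>S\<close>, as a
  single identity of power series. Formally it is the logarithmic derivative of the product \<open>q\<close>: as
  \<open>F = (\<Sum>z\<in>S. 1 / (1 - z * X))\<close>, it reads \<open>- X * q' / q = F - card S\<close>.\<close>

lemma newton_generating_function:
  fixes S :: "complex set"
  assumes "finite S"
  defines "q \<equiv> (\<Prod>z\<in>S. 1 - fps_const z * fps_X)"
  defines "F \<equiv> Abs_fps (\<lambda>m. \<Sum>z\<in>S. z ^ m)"
  shows "q * F = of_nat (card S) * q - fps_X * fps_deriv q"
  unfolding q_def F_def using assms(1)
proof (induction S rule: finite_induct)
  case empty
  show ?case by (simp add: fps_eq_iff)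
next
  case (insert w S)
  define q where "q = (\<Prod>z\<in>S. 1 - fps_const z * fps_X)"
  define F where "F = Abs_fps (\<lambda>m. \<Sum>z\<in>S. z ^ m)"
  define G where "G = Abs_fps (\<lambda>m. w ^ m)"
  define l where "l = 1 - fps_const w * fps_X"
  have lG: "l * G = 1"
    unfolding l_def G_def
    by (rule fps_ext, rename_tac n, case_tac n) (simp_all add: left_diff_distrib mult.assoc)
  have dl: "fps_deriv l = - fps_const w" by (simp add: l_def)
  have Xw: "fps_const w * fps_X = 1 - l" by (simp add: l_def)
  have ins: "(\<Prod>z\<in>insert w S. 1 - fps_const z * fps_X) = l * q"
    using insert.hyps by (simp add: l_def q_def)
  have insF: "Abs_fps (\<lambda>m. \<Sum>z\<in>insert w S. z ^ m) = G + F"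
    using insert.hyps by (simp add: F_def G_def fps_eq_iff)
  have IH: "q * F = of_nat (card S) * q - fps_X * fps_deriv q"
    using insert.IH by (simp add: q_def F_def)
  have "l * q * (G + F) = q * (l * G) + l * (q * F)" by (simp add: algebra_simps)
  also have "\<dots> = q + l * (of_nat (card S) * q - fps_X * fps_deriv q)"
    by (simp add: lG IH)
  also have "\<dots> = of_nat (card S) * (l * q) + q * l + q * (fps_const w * fps_X) - fps_X * (l * fps_deriv q)"
    unfolding Xw by (simp add: algebra_simps)
  also have "\<dots> = of_nat (card (insert w S)) * (l * q) - fps_X * fps_deriv (l * q)"
    using insert.hyps by (simp add: dl algebra_simps fps_const_neg[symmetric] del: fps_const_neg)
  finally show ?case unfolding ins insF .
qed

text \<open>The product \<open>q\<close> of the preceding lemma is the reflected polynomial \<open>Q\<close>: it has integer coefficients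
  and constant term 1. Comparing coefficients therefore expresses each power sum as an integer
  combination of earlier ones and of the coefficients of \<open>q\<close>.\<close>

lemma sum_root_powers_in_Ints:
  fixes Q :: "int poly" and S :: "complex set"
  assumes "finite S" "map_poly of_int Q = (\<Prod>z\<in>S. [:-z, 1:])"
  shows "(\<Sum>z\<in>S. z ^ m) \<in> \<int>"
proof -
  define q where "q = (\<Prod>z\<in>S. 1 - fps_const z * fps_X)"
  define F where "F = Abs_fps (\<lambda>m. \<Sum>z\<in>S. z ^ m)"
  have refl: "reflect_poly [:-z, 1:] = [:1, -z:]" for z :: complex
    by (rule poly_eqI) (auto simp: coeff_reflect_poly coeff_pCons split: nat.splits)
  have linear: "fps_of_poly [:1, -z:] = 1 - fps_const z * fps_X" for z :: complex
    by (simp add: fps_of_poly_pCons fps_const_neg[symmetric] del: fps_const_neg)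
  have "q = fps_of_poly (reflect_poly (map_poly of_int Q))"
    unfolding q_def assms(2) reflect_poly_prod fps_of_poly_prod refl linear ..
  hence q_int: "fps_nth q n \<in> \<int>" for n
    by (simp add: coeff_reflect_poly)
  have q0: "fps_nth q 0 = 1" unfolding q_def using assms(1) by (induction S rule: finite_induct) auto
  have eq: "q * F = of_nat (card S) * q - fps_X * fps_deriv q"
    unfolding q_def F_def by (rule newton_generating_function[OF assms(1)])
  have "fps_nth F m \<in> \<int>" 
  proof (induction m rule: less_induct)
    case (less m)
    have "fps_nth (q * F) m = fps_nth F m + (\<Sum>i=1..m. fps_nth q i * fps_nth F (m - i))"
      by (simp add: fps_mult_nth sum.atLeast_Suc_atMost q0)
    moreover have "(\<Sum>i=1..m. fps_nth q i * fps_nth F (m - i)) \<in> \<int>"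
      using less q_int by (intro Ints_sum Ints_mult) auto
    moreover have "fps_nth (q * F) m \<in> \<int>"
      unfolding eq using q_int by (cases m) (auto simp: fps_of_nat[symmetric] intro!: Ints_mult Ints_diff)
    ultimately show ?case by (metis Ints_diff add_diff_cancel_right')
  qed
  thus ?thesis by (simp add: F_def)
qed

text \<open>Here \<open>\<tau> m\<close> is the sum of the \<open>m\<close>-th powers of the conjugates other than \<open>\<beta>\<close>.\<close>

lemma pisot_near_integer_powers:
  assumes "pisot_number \<beta>"
  obtains \<tau> :: "nat \<Rightarrow> real" and C \<rho> :: real
  where "0 < \<rho>" "\<rho> < 1" "0 \<le> C" "\<And>m. \<bar>\<tau> m\<bar> \<le> C * \<rho> ^ m" "\<And>m. \<beta> ^ m + \<tau> m \<in> \<int>"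
proof -
  let ?b = "complex_of_real \<beta>"
  have b: "algebraic_int \<beta>" and conj: "\<And>z. conjugate_of ?b z \<Longrightarrow> z \<noteq> ?b \<Longrightarrow> norm z < 1"
    using assms by (auto simp: pisot_number_def)
  obtain P :: "int poly" where P: "poly (map_poly of_int P) \<beta> = 0" "lead_coeff P = 1"
    using b by (auto simp: algebraic_int_altdef_ipoly)
  have "poly (map_poly of_real (map_poly of_int P)) ?b = 0"
    by (simp only: of_real_hom.poly_map_poly P(1) of_real_0)
  hence "algebraic_int ?b"
    unfolding algebraic_int_altdef_ipoly using P(2) by (auto simp: map_poly_map_poly o_def)
  then obtain Q :: "int poly" where Q: "lead_coeff Q = 1" "irreducible (map_poly rat_of_int Q)"
    "poly (map_poly of_int Q) ?b = 0"
    by (rule algebraic_int_minimal_polynomial)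
  let ?q = "map_poly of_int Q :: complex poly"
  have Qrat: "map_poly of_rat (map_poly rat_of_int Q) = ?q"
    by (simp add: map_poly_map_poly o_def)
  define S where "S = {z. poly ?q z = 0}"
  have "?q \<noteq> 0" using Q(1) by auto
  hence fin: "finite S" unfolding S_def by (rule poly_roots_finite)
  have split: "?q = (\<Prod>z\<in>S. [:-z, 1:])"
    using complex_poly_decompose_rsquarefree[OF irreducible_rat_poly_rsquarefree[OF Q(2)]] Q(1)
    by (simp add: Qrat S_def)
  have bS: "?b \<in> S" using Q(3) by (simp add: S_def)
  have small: "norm z < 1" if "z \<in> S - {?b}" for z
    using that Q conj[of z] unfolding conjugate_of_def S_def Qrat[symmetric] by blast
  \<comment> \<open>The value 1/2 keeps \<open>\<rho>\<close> well defined and positive when the other conjugates are absent or 0.\<close>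
  define \<rho> where "\<rho> = Max (insert (1/2) (norm ` (S - {?b})))"
  define s where "s m = (\<Sum>z\<in>S - {?b}. z ^ m)" for m
  have rho: "0 < \<rho>" "\<rho> < 1"
  proof -
    have "1/2 \<le> \<rho>" unfolding \<rho>_def using fin by (intro Max_ge) auto
    thus "0 < \<rho>" by simp
    show "\<rho> < 1" unfolding \<rho>_def using fin small by (subst Max_less_iff) auto
  qed
  have s_le: "norm (s m) \<le> real (card S) * \<rho> ^ m" for m
  proof -
    have "norm z ^ m \<le> \<rho> ^ m" if "z \<in> S - {?b}" for z
      unfolding \<rho>_def using that fin by (intro power_mono Max_ge) auto
    hence "norm (s m) \<le> real (card (S - {?b})) * \<rho> ^ m"
      unfolding s_def by (intro sum_norm_bound) (simp add: norm_power)
    also have "\<dots> \<le> real (card S) * \<rho> ^ m"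
      using rho fin by (intro mult_right_mono) (auto intro: card_mono)
    finally show ?thesis .
  qed
  have int: "?b ^ m + s m \<in> \<int>" for m
    using sum_root_powers_in_Ints[OF fin split, of m] sum.remove[OF fin bS, of "\<lambda>z. z ^ m"]
    by (simp add: s_def)
  show ?thesis
  proof (rule that[OF rho])
    show "0 \<le> real (card S)" by simp
    show "\<bar>Re (s m)\<bar> \<le> real (card S) * \<rho> ^ m" for m
      using s_le[of m] abs_Re_le_cmod[of "s m"] by linarith
    show "\<beta> ^ m + Re (s m) \<in> \<int>" for m
    proof -
      obtain k where "?b ^ m + s m = of_int k" using int[of m] by (elim Ints_cases)
      hence "Re (?b ^ m + s m) = of_int k" by simp
      thus ?thesis by (simp add: of_real_power[symmetric] del: of_real_power)
    qed
  qed
qed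

section \<open>Forward invariant sets that avoid a neighbourhood of 0\<close>

lemma borel_measurable_frac_real [measurable]: "(frac :: real \<Rightarrow> real) \<in> borel_measurable borel"
  unfolding frac_def[abs_def] by measurable

lemma lmeasurable_subset_interval:
  fixes S :: "real set"
  assumes "S \<in> sets lebesgue" "S \<subseteq> {a..<b}"
  shows "S \<in> lmeasurable"
proof (rule bounded_set_imp_lmeasurable[OF _ assms(1)])
  show "bounded S"
    using assms(2) by (intro bounded_subset[OF bounded_closed_interval[of a b]]) auto
qed

text \<open>Beyond the first unit interval, the 1-periodic extension of \<open>A\<close> is a translate of itself.\<close>

lemma measure_frac_vimage_split:
  fixes A :: "real set"
  assumes A: "A \<in> sets borel" and u: "0 \<le> u" "u \<le> 1" and t: "1 < t"
  shows "measure lebesgue {y \<in> {u..<t}. frac y \<in> A}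
    \<le> measure lebesgue (A \<inter> {u..<1}) + measure lebesgue {y \<in> {0..<t - 1}. frac y \<in> A}"
proof -
  define F where "F p q = {y \<in> {p..<q}. frac y \<in> A}" for p q
  have "F p q \<in> sets borel" for p q
    unfolding F_def using A by measurable
  hence F: "F p q \<in> sets lebesgue" for p q by (metis sets_completionI_sets sets_lborel)
  have A1: "A \<inter> {u..<1} \<in> sets lebesgue"
    using A by (intro sets_completionI_sets) auto
  let ?B = "(+) 1 ` F 0 (t - 1)"
  have B: "?B \<in> sets lebesgue" using F by (intro lebesgue_sets_translation)
  have sub: "F u t \<subseteq> (A \<inter> {u..<1}) \<union> ?B"
  proof
    fix y assume y: "y \<in> F u t"
    show "y \<in> (A \<inter> {u..<1}) \<union> ?B"
    proof (cases "y < 1")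
      case True
      hence "frac y = y" using y u by (simp add: F_def frac_eq)
      thus ?thesis using y True by (simp add: F_def)
    next
      case False
      have "frac (y - 1) = frac y" by (simp add: frac_def)
      hence "y - 1 \<in> F 0 (t - 1)" using y False by (auto simp: F_def)
      thus ?thesis by (intro UnI2 image_eqI[of _ _ "y - 1"]) auto
    qed
  qed
  have "measure lebesgue (F u t) \<le> measure lebesgue ((A \<inter> {u..<1}) \<union> ?B)"
  proof (rule measure_mono_fmeasurable[OF sub F])
    show "(A \<inter> {u..<1}) \<union> ?B \<in> lmeasurable"
    proof (rule lmeasurable_subset_interval)
      show "(A \<inter> {u..<1}) \<union> ?B \<subseteq> {0..<t}" using u t by (auto simp: F_def)
    qed (use A1 B in blast)
  qed
  also have "\<dots> \<le> measure lebesgue (A \<inter> {u..<1}) + measure lebesgue ?B"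
    by (rule measure_Un_le[OF A1 B])
  also have "measure lebesgue ?B = measure lebesgue (F 0 (t - 1))"
    by (rule measure_translation)
  finally show ?thesis by (simp only: F_def)
qed

lemma measure_frac_vimage_le:
  fixes A :: "real set"
  assumes A: "A \<in> sets borel"
    and le: "\<And>t. 0 \<le> t \<Longrightarrow> t \<le> 1 \<Longrightarrow> measure lebesgue (A \<inter> {0..<t}) \<le> s * t"
    and t: "0 \<le> t"
  shows "measure lebesgue {y \<in> {0..<t}. frac y \<in> A} \<le> s * t"
proof -
  have "0 \<le> t \<Longrightarrow> t \<le> real n \<Longrightarrow> measure lebesgue {y \<in> {0..<t}. frac y \<in> A} \<le> s * t" for n t
  proof (induction n arbitrary: t)
    case 0
    thus ?case by simp
  next
    case (Suc n)
    show ?case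
    proof (cases "t \<le> 1")
      case True
      have "{y \<in> {0..<t}. frac y \<in> A} = A \<inter> {0..<t}" using True by (auto simp: frac_eq)
      thus ?thesis using le[of t] Suc.prems True by simp
    next
      case False
      have "measure lebesgue {y \<in> {0..<t - 1}. frac y \<in> A} \<le> s * (t - 1)"
        using Suc.prems False by (intro Suc.IH) auto
      thus ?thesis
        using measure_frac_vimage_split[OF A, of 0 t] le[of 1] False
        unfolding right_diff_distrib by linarith
    qed
  qed
  thus ?thesis using t real_nat_ceiling_ge by blast
qed

text \<open>The self-improvement that makes forward invariant sets negligible: a density bound \<open>s\<close> on
  initial segments persists on \<open>[1 / \<beta> ^ j, t)\<close>. Indeed multiplication by \<open>\<beta>\<close> carries
  \<open>A \<inter> [1 / \<beta> ^ Suc j, t)\<close> into the part of the 1-periodic extension of \<open>A\<close> over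
  \<open>[1 / \<beta> ^ j, \<beta> * t)\<close>; the bound holds up to 1 by induction, and beyond 1
  the extension starts afresh at an integer.\<close>

lemma measure_forward_invariant_le:
  fixes A :: "real set"
  assumes A: "A \<in> sets borel" "A \<subseteq> {0..<1}" and b: "\<beta> > 1"
    and inv: "\<And>x. x \<in> A \<Longrightarrow> frac (\<beta> * x) \<in> A"
    and le: "\<And>t. 0 \<le> t \<Longrightarrow> t \<le> 1 \<Longrightarrow> measure lebesgue (A \<inter> {0..<t}) \<le> s * t"
    and t: "1 / \<beta> ^ j \<le> t" "t \<le> 1"
  shows "measure lebesgue (A \<inter> {1 / \<beta> ^ j..<t}) \<le> s * (t - 1 / \<beta> ^ j)"
  using t
proof (induction j arbitrary: t)
  case 0
  thus ?case by simp
next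
  case (Suc j)
  define u where "u = 1 / \<beta> ^ j"
  define G where "G = {y \<in> {u..<\<beta> * t}. frac y \<in> A}"
  have u: "0 < u" "u \<le> 1" using b by (auto simp: u_def one_le_power)
  have ut: "u \<le> \<beta> * t" using Suc.prems b by (simp add: u_def field_simps)
  have G: "G \<in> sets borel" unfolding G_def using A(1) by measurable
  have Gle: "measure lebesgue G \<le> s * (\<beta> * t - u)"
  proof (cases "\<beta> * t \<le> 1")
    case True
    have "G = A \<inter> {u..<\<beta> * t}" using True u by (auto simp: G_def frac_eq)
    thus ?thesis using Suc.IH[of "\<beta> * t"] ut True by (simp add: u_def)
  next
    case False
    have "measure lebesgue (A \<inter> {u..<1}) \<le> s * (1 - u)"
      using Suc.IH[of 1] u by (simp add: u_def)
    moreover have "measure lebesgue {y \<in> {0..<\<beta> * t - 1}. frac y \<in> A} \<le> s * (\<beta> * t - 1)"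
      using False by (intro measure_frac_vimage_le[OF A(1) le]) auto
    ultimately show ?thesis
      using measure_frac_vimage_split[OF A(1), of u "\<beta> * t"] u False
      unfolding G_def right_diff_distrib by linarith
  qed
  let ?im = "(\<lambda>y. (1 / \<beta>) *\<^sub>R y + 0) ` G"
  have sub: "A \<inter> {1 / \<beta> ^ Suc j..<t} \<subseteq> ?im"
  proof
    fix x assume x: "x \<in> A \<inter> {1 / \<beta> ^ Suc j..<t}"
    hence "\<beta> * x \<in> G" using inv[of x] b by (auto simp: G_def u_def field_simps)
    thus "x \<in> ?im" using b by (intro image_eqI[of _ _ "\<beta> * x"]) auto
  qed
  have imG: "?im \<in> lmeasurable"
  proof (rule lmeasurable_subset_interval)
    have "G \<subseteq> {0..<\<beta> * t}" using u(1) by (auto simp: G_def)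
    thus "?im \<subseteq> {0..<t}" using b by (fastforce simp: field_simps)
    have "?im = (\<lambda>x. x * \<beta>) -` G \<inter> UNIV" using b by (auto simp: image_iff field_simps)
    also have "\<dots> \<in> sets borel" using G by measurable
    finally show "?im \<in> sets lebesgue" by (metis sets_completionI_sets sets_lborel)
  qed
  have "A \<inter> {1 / \<beta> ^ Suc j..<t} \<in> sets lebesgue"
    using A(1) by (intro sets_completionI_sets) auto
  hence "measure lebesgue (A \<inter> {1 / \<beta> ^ Suc j..<t}) \<le> measure lebesgue ?im"
    by (intro measure_mono_fmeasurable[OF sub _ imG])
  also have "\<dots> = (1 / \<beta>) * measure lebesgue G"
    using measure_lebesgue_affine[of "1 / \<beta>" 0 G] b by simp
  also have "\<dots> \<le> (1 / \<beta>) * (s * (\<beta> * t - u))"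
    using Gle b by (intro mult_left_mono) auto
  also have "\<dots> = s * (t - 1 / \<beta> ^ Suc j)" using b by (simp add: u_def field_simps)
  finally show ?case .
qed

text \<open>As \<open>A\<close> has no points in \<open>[0, \<delta>)\<close>, where \<open>\<delta> = 1 / \<beta> ^ L\<close>, the preceding lemma turns the density bound
  \<open>s\<close> into \<open>s * (t - \<delta>) \<le> s * (1 - \<delta>) * t\<close> for \<open>t \<le> 1\<close>, that is, into the density bound \<open>s * (1 - \<delta>)\<close>.
  Iteration, starting from \<open>s = 1\<close>, brings the density to 0.\<close>

lemma forward_invariant_null:
  fixes A :: "real set"
  assumes A: "A \<in> sets borel" "A \<subseteq> {1 / \<beta> ^ L..<1}" and b: "\<beta> > 1"
    and inv: "\<And>x. x \<in> A \<Longrightarrow> frac (\<beta> * x) \<in> A"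
  shows "A \<in> null_sets lborel"
proof -
  define \<delta> where "\<delta> = 1 / \<beta> ^ L"
  have d: "0 < \<delta>" "\<delta> \<le> 1" using b by (auto simp: \<delta>_def one_le_power)
  have A01: "A \<subseteq> {0..<1}" using A(2) d unfolding \<delta>_def[symmetric] by fastforce
  have A_fm: "A \<in> fmeasurable lebesgue"
    using A(1) by (intro lmeasurable_subset_interval[OF _ A01] sets_completionI_sets) auto
  have bound: "0 \<le> t \<Longrightarrow> t \<le> 1 \<Longrightarrow> measure lebesgue (A \<inter> {0..<t}) \<le> (1 - \<delta>) ^ n * t" for n t
  proof (induction n arbitrary: t)
    case 0
    have "measure lebesgue (A \<inter> {0..<t}) \<le> measure lebesgue {0..<t}"
      using A(1) by (intro measure_mono_fmeasurable sets_completionI_sets lmeasurable_subset_interval[of _ 0 t]) auto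
    thus ?case using 0 by simp
  next
    case (Suc n)
    have split: "A \<inter> {0..<t} = A \<inter> {\<delta>..<t}" using A(2) d unfolding \<delta>_def[symmetric] by fastforce
    show ?case
    proof (cases "\<delta> \<le> t")
      case True
      have "measure lebesgue (A \<inter> {\<delta>..<t}) \<le> (1 - \<delta>) ^ n * (t - \<delta>)"
        using measure_forward_invariant_le[OF A(1) A01 b inv Suc.IH, of L t] True Suc.prems d
        by (simp add: \<delta>_def)
      also have "\<dots> \<le> (1 - \<delta>) ^ n * ((1 - \<delta>) * t)"
        using d Suc.prems mult_left_mono[of t 1 \<delta>] by (intro mult_left_mono) (auto simp: algebra_simps)
      finally show ?thesis unfolding split by (simp add: algebra_simps)
    next
      case False
      hence "A \<inter> {\<delta>..<t} = {}" by auto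
      thus ?thesis unfolding split using d Suc.prems by simp
    qed
  qed
  have "(\<lambda>n. (1 - \<delta>) ^ n) \<longlonglongrightarrow> 0" using d by (intro LIMSEQ_power_zero) auto
  moreover have "measure lebesgue A \<le> (1 - \<delta>) ^ n" for n
    using bound[of 1 n] A01 by (simp add: Int_absorb2)
  ultimately have "measure lebesgue A \<le> 0" by (intro LIMSEQ_le_const) auto
  hence "emeasure lebesgue A = 0"
    using A_fm by (metis emeasure_eq_measure2 ennreal_eq_0_iff)
  hence "emeasure lborel A = 0" using A(1) by simp
  thus ?thesis using A(1) by auto
qed

section \<open>The invariant measure near 0\<close>

abbreviation (input) beta_map :: "real \<Rightarrow> real \<Rightarrow> real" where
  "beta_map \<beta> \<equiv> \<lambda>y. frac (\<beta> * y)"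

context
  fixes \<beta> :: real and \<mu> :: "real measure"
  assumes b: "\<beta> > 1" and inv: "beta_invariant_measure \<beta> \<mu>"
begin

lemma prob_space_beta: "prob_space \<mu>"
  using inv by (simp add: beta_invariant_measure_def)

lemma sets_beta: "sets \<mu> = sets (restrict_space borel {0..<1})"
  using inv by (simp add: beta_invariant_measure_def)

lemma space_beta: "space \<mu> = {0..<1}"
  using sets_eq_imp_space_eq[OF sets_beta] by (simp add: space_restrict_space)

lemma interval_in_sets_beta: "{0..<1 / \<beta> ^ L} \<in> sets \<mu>"
proof -
  have "1 / \<beta> ^ L \<le> 1" using b by (simp add: one_le_power)
  hence "{0..<1 / \<beta> ^ L} = {0..<1} \<inter> {0..<1 / \<beta> ^ L}" by auto
  moreover have "{0..<1 / \<beta> ^ L} \<in> sets borel" by simp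
  ultimately show ?thesis unfolding sets_beta sets_restrict_space by (rule image_eqI)
qed

lemma null_imp_null_beta:
  assumes "N \<in> null_sets lborel" "N \<subseteq> {0..<1}"
  shows "N \<in> null_sets \<mu>"
proof -
  have "N \<in> null_sets (restrict_space lborel {0..<1})"
    using assms by (simp add: null_sets_restrict_space)
  thus ?thesis using inv by (auto simp: beta_invariant_measure_def absolutely_continuous_def)
qed

lemma AE_beta_iterate:
  assumes "AE x in \<mu>. P x"
  shows "AE x in \<mu>. P ((beta_map \<beta> ^^ n) x)"
proof (induction n)
  case 0
  thus ?case using assms by simp
next
  case (Suc n)
  have "beta_map \<beta> \<in> \<mu> \<rightarrow>\<^sub>M \<mu>"
    unfolding measurable_cong_sets[OF sets_beta sets_beta]
    by (intro measurable_restrict_space3) (measurable, auto simp: frac_lt_1)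
  moreover have "AE x in distr \<mu> \<mu> (beta_map \<beta>). P ((beta_map \<beta> ^^ n) x)"
    using Suc inv unfolding beta_invariant_measure_def by metis
  ultimately have "AE x in \<mu>. P ((beta_map \<beta> ^^ n) (beta_map \<beta> x))" by (rule AE_distrD)
  thus ?case by (simp only: funpow_Suc_right o_apply)
qed

text \<open>If \<open>[0, 1 / \<beta> ^ L)\<close> had measure 0, then by invariance almost every orbit would avoid it. The set of
  points whose orbit does so is forward invariant, hence Lebesgue null, hence of measure 0.\<close>

lemma beta_measure_near_zero_pos: "measure \<mu> {0..<1 / \<beta> ^ L} > 0"
proof (rule ccontr)
  interpret prob_space \<mu> by (rule prob_space_beta)
  define A where "A = {x \<in> {0..<1}. \<forall>n. 1 / \<beta> ^ L \<le> (beta_map \<beta> ^^ n) x}"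
  assume "\<not> measure \<mu> {0..<1 / \<beta> ^ L} > 0"
  hence "measure \<mu> {0..<1 / \<beta> ^ L} = 0" by (simp add: order.antisym)
  hence "{0..<1 / \<beta> ^ L} \<in> null_sets \<mu>"
    using interval_in_sets_beta by (auto simp: emeasure_eq_measure)
  hence "AE x in \<mu>. x \<notin> {0..<1 / \<beta> ^ L}" by (rule AE_not_in)
  hence "AE x in \<mu>. 1 / \<beta> ^ L \<le> x" using AE_space by eventually_elim (auto simp: space_beta)
  hence "AE x in \<mu>. \<forall>n. 1 / \<beta> ^ L \<le> (beta_map \<beta> ^^ n) x"
    using AE_beta_iterate by (simp add: AE_all_countable)
  hence in_A: "AE x in \<mu>. x \<in> A" using AE_space by eventually_elim (auto simp: A_def space_beta)
  have "(beta_map \<beta> ^^ n) \<in> borel_measurable borel" for n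
  proof (induction n)
    case (Suc n)
    have [measurable]: "(beta_map \<beta> ^^ n) \<in> borel_measurable borel" by (rule Suc)
    show ?case unfolding funpow.simps o_def by measurable
  qed (simp add: id_def)
  hence [measurable]: "\<And>n. (beta_map \<beta> ^^ n) \<in> borel_measurable borel" .
  have "A \<in> null_sets lborel"
  proof (rule forward_invariant_null[OF _ _ b])
    show "A \<in> sets borel" unfolding A_def by measurable
    show "A \<subseteq> {1 / \<beta> ^ L..<1}"
    proof
      fix x assume "x \<in> A"
      hence "x < 1" and all: "\<forall>n. 1 / \<beta> ^ L \<le> (beta_map \<beta> ^^ n) x" by (auto simp: A_def)
      from all have "1 / \<beta> ^ L \<le> (beta_map \<beta> ^^ 0) x" by (rule spec)
      with \<open>x < 1\<close> show "x \<in> {1 / \<beta> ^ L..<1}" by simp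
    qed
    fix x assume x: "x \<in> A"
    have "1 / \<beta> ^ L \<le> (beta_map \<beta> ^^ n) (beta_map \<beta> x)" for n
    proof -
      have "1 / \<beta> ^ L \<le> (beta_map \<beta> ^^ Suc n) x" using x unfolding A_def by blast
      thus ?thesis by (simp only: funpow_Suc_right o_apply)
    qed
    thus "beta_map \<beta> x \<in> A" by (auto simp: A_def frac_lt_1)
  qed
  hence "AE x in \<mu>. x \<notin> A" by (intro AE_not_in null_imp_null_beta) (auto simp: A_def)
  with in_A have "AE x in \<mu>. False" by eventually_elim auto
  thus False by (simp add: AE_False)
qed

text \<open>The intervals \<open>[0, 1 / \<beta> ^ L)\<close> shrink to \<open>{0}\<close>, and an absolutely continuous measure has no atom.\<close>

lemma beta_measure_near_zero_lt_1: "\<exists>L. measure \<mu> {0..<1 / \<beta> ^ L} \<noteq> 1"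
proof (rule ccontr)
  interpret prob_space \<mu> by (rule prob_space_beta)
  assume "\<nexists>L. measure \<mu> {0..<1 / \<beta> ^ L} \<noteq> 1"
  hence "AE x in \<mu>. x \<in> {0..<1 / \<beta> ^ L}" for L
    using AE_in_set_eq_1[OF interval_in_sets_beta[of L]] by simp
  hence "AE x in \<mu>. \<forall>L. x \<in> {0..<1 / \<beta> ^ L}" unfolding AE_all_countable by blast
  moreover have "AE x in \<mu>. x \<notin> {0}" by (intro AE_not_in null_imp_null_beta) auto
  ultimately have "AE x in \<mu>. False"
  proof eventually_elim
    fix x assume x: "\<forall>L. x \<in> {0..<1 / \<beta> ^ L}" "x \<notin> {0}"
    hence "0 < x" by (metis atLeastLessThan_iff insert_iff less_eq_real_def)
    then obtain L where "(1 / \<beta>) ^ L < x" using real_arch_pow_inv[of x "1 / \<beta>"] b by auto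
    thus False using x(1)[rule_format, of L] by (simp add: power_one_over)
  qed
  thus False by (simp add: AE_False)
qed

end

section \<open>Digits and zero blocks\<close>

lemma beta_map_iterate_bounds:
  assumes "x \<in> {0..<1}"
  shows "0 \<le> (beta_map \<beta> ^^ n) x" "(beta_map \<beta> ^^ n) x < 1"
  using assms by (cases n; simp add: frac_lt_1)+

lemma beta_expansion_step:
  assumes b: "\<beta> > 1" and x: "x \<in> {0..<1}"
  shows "\<beta> * (beta_map \<beta> ^^ n) x = real (beta_expansion \<beta> x n) + (beta_map \<beta> ^^ Suc n) x"
proof -
  have "beta_expansion \<beta> x n = nat \<lfloor>\<beta> * (beta_map \<beta> ^^ n) x\<rfloor>"
    using is_beta_expansion_unique[OF b is_beta_expansion_beta_expansion[OF b x]] .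
  moreover have "\<lfloor>\<beta> * (beta_map \<beta> ^^ n) x\<rfloor> \<ge> 0"
    using beta_map_iterate_bounds(1)[OF x, of n \<beta>] b by simp
  ultimately show ?thesis by (simp add: frac_def)
qed

lemma beta_map_iterate_zero_run:
  assumes b: "\<beta> > 1" and x: "x \<in> {0..<1}" and "m \<le> n"
    and "\<And>i. m \<le> i \<Longrightarrow> i < n \<Longrightarrow> beta_expansion \<beta> x i = 0"
  shows "(beta_map \<beta> ^^ n) x = \<beta> ^ (n - m) * (beta_map \<beta> ^^ m) x"
  using assms(3,4)
proof (induction n rule: dec_induct)
  case base
  show ?case by simp
next
  case (step n)
  have "(beta_map \<beta> ^^ Suc n) x = \<beta> * (beta_map \<beta> ^^ n) x"
    using beta_expansion_step[OF b x, of n] step.prems[of n] step.hyps by simp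
  also have "\<dots> = \<beta> * (\<beta> ^ (n - m) * (beta_map \<beta> ^^ m) x)"
    using step by simp
  finally show ?case using step.hyps by (simp add: Suc_diff_le)
qed

lemma zero_block_cylinder:
  assumes b: "\<beta> > 1"
  shows "{x \<in> {0..<1}. occurs_at (replicate L 0) (beta_expansion \<beta> x) 0} = {0..<1 / \<beta> ^ L}"
proof (intro Set.set_eqI iffI)
  fix x assume "x \<in> {x \<in> {0..<1}. occurs_at (replicate L 0) (beta_expansion \<beta> x) 0}"
  hence x: "x \<in> {0..<1}" and z: "\<And>i. i < L \<Longrightarrow> beta_expansion \<beta> x i = 0"
    by (auto simp: occurs_at_def)
  have "\<beta> ^ L * x < 1"
    using beta_map_iterate_zero_run[OF b x, of 0 L] z beta_map_iterate_bounds(2)[OF x, of L \<beta>] by simp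
  thus "x \<in> {0..<1 / \<beta> ^ L}" using x b by (simp add: field_simps)
next
  fix x assume x: "x \<in> {0..<1 / \<beta> ^ L}"
  have "1 / \<beta> ^ L \<le> 1" using b by (simp add: one_le_power)
  hence x01: "x \<in> {0..<1}" using x by auto
  have "beta_expansion \<beta> x i = 0" if "i < L" for i
    using that
  proof (induction i rule: less_induct)
    case (less i)
    have "\<beta> * (beta_map \<beta> ^^ i) x = \<beta> ^ Suc i * x"
      using beta_map_iterate_zero_run[OF b x01, of 0 i] less by simp
    also have "\<dots> \<le> \<beta> ^ L * x" using power_increasing[of "Suc i" L \<beta>] less.prems x01 b
      by (intro mult_right_mono) (simp_all del: power_Suc)
    also have "\<dots> < 1" using x b by (simp add: field_simps)
    finally have "real (beta_expansion \<beta> x i) < 1"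
      using beta_expansion_step[OF b x01, of i] beta_map_iterate_bounds(1)[OF x01, of "Suc i" \<beta>] by linarith
    thus ?case by simp
  qed
  thus "x \<in> {x \<in> {0..<1}. occurs_at (replicate L 0) (beta_expansion \<beta> x) 0}"
    using x01 by (simp add: occurs_at_def)
qed

lemma admissible_zero_block:
  assumes "\<beta> > 1"
  shows "admissible_block \<beta> (replicate L 0)"
proof -
  have "(0 :: real) \<in> {x \<in> {0..<1}. occurs_at (replicate L 0) (beta_expansion \<beta> x) 0}"
    unfolding zero_block_cylinder[OF assms] using assms by simp
  thus ?thesis unfolding admissible_block_def by blast
qed

lemma eventually_always_freq:
  assumes "\<And>n. n \<ge> n0 \<Longrightarrow> P n"
  shows "(\<lambda>N. real (card {n \<in> {..<N}. P n}) / real N) \<longlonglongrightarrow> 1"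
proof (rule tendsto_sandwich)
  show "\<forall>\<^sub>F N in sequentially. 1 - real n0 / real N \<le> real (card {n \<in> {..<N}. P n}) / real N"
  proof (intro eventually_sequentiallyI[of "Suc n0"])
    fix N assume N: "Suc n0 \<le> N"
    have "card {n0..<N} \<le> card {n \<in> {..<N}. P n}" using assms by (intro card_mono) auto
    hence "real N - real n0 \<le> real (card {n \<in> {..<N}. P n})" using N by simp
    thus "1 - real n0 / real N \<le> real (card {n \<in> {..<N}. P n}) / real N"
      using N by (simp add: field_simps)
  qed
  show "\<forall>\<^sub>F N in sequentially. real (card {n \<in> {..<N}. P n}) / real N \<le> 1"
  proof (intro always_eventually allI)
    fix N
    have "card {n \<in> {..<N}. P n} \<le> card {..<N}" by (intro card_mono) auto
    thus "real (card {n \<in> {..<N}. P n}) / real N \<le> 1"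
      by (cases "N = 0") (simp_all add: divide_le_eq_1)
  qed
  have "(\<lambda>N. 1 - real n0 / real N) \<longlonglongrightarrow> 1 - 0"
    by (intro tendsto_diff tendsto_const lim_const_over_n)
  thus "(\<lambda>N. 1 - real n0 / real N) \<longlonglongrightarrow> 1" by simp
qed simp

text \<open>A zero block of length \<open>L\<close> occurs since its frequency is positive, and it is followed by a nonzero
  digit since otherwise the blocks of zeros of every length would have frequency 1.\<close>

lemma normal_long_zero_run:
  assumes b: "\<beta> > 1" and \<alpha>: "\<alpha> \<in> {0..<1}" and "normal_to_base \<beta> \<alpha>"
  obtains m n where "m + L \<le> n" "\<And>i. m \<le> i \<Longrightarrow> i < n \<Longrightarrow> beta_expansion \<beta> \<alpha> i = 0"
    "beta_expansion \<beta> \<alpha> n \<noteq> 0"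
proof -
  define d where "d = beta_expansion \<beta> \<alpha>"
  obtain \<mu> where inv: "beta_invariant_measure \<beta> \<mu>"
    and freq: "\<And>w. admissible_block \<beta> w \<Longrightarrow>
         (\<lambda>N. real (card {n \<in> {..<N}. occurs_at w d n}) / real N)
           \<longlonglongrightarrow> measure \<mu> {x \<in> {0..<1}. occurs_at w (beta_expansion \<beta> x) 0}"
    using assms(3) unfolding normal_to_base_def d_def by blast
  have freq0: "(\<lambda>N. real (card {n \<in> {..<N}. occurs_at (replicate L 0) d n}) / real N)
      \<longlonglongrightarrow> measure \<mu> {0..<1 / \<beta> ^ L}" for L
    using freq[OF admissible_zero_block[OF b]] unfolding zero_block_cylinder[OF b] .
  have "\<exists>m. occurs_at (replicate L 0) d m"
  proof (rule ccontr)
    assume "\<nexists>m. occurs_at (replicate L 0) d m"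
    hence "(\<lambda>N. 0) \<longlonglongrightarrow> measure \<mu> {0..<1 / \<beta> ^ L}" using freq0[of L] by simp
    thus False using beta_measure_near_zero_pos[OF b inv, of L] by (simp add: LIMSEQ_const_iff)
  qed
  then obtain m where m: "\<And>i. i < L \<Longrightarrow> d (m + i) = 0" by (auto simp: occurs_at_def)
  have "\<exists>n\<ge>m. d n \<noteq> 0"
  proof (rule ccontr)
    assume "\<not> (\<exists>n\<ge>m. d n \<noteq> 0)"
    hence "occurs_at (replicate K 0) d n" if "n \<ge> m" for n K
      using that by (simp add: occurs_at_def)
    hence "measure \<mu> {0..<1 / \<beta> ^ K} = 1" for K
      by (intro LIMSEQ_unique[OF freq0 eventually_always_freq[of m]])
    thus False using beta_measure_near_zero_lt_1[OF b inv] by blast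
  qed
  then obtain n' where n': "n' \<ge> m" "d n' \<noteq> 0" by blast
  define n where "n = (LEAST n. n \<ge> m \<and> d n \<noteq> 0)"
  have n: "n \<ge> m" "d n \<noteq> 0"
    using LeastI[of "\<lambda>n. n \<ge> m \<and> d n \<noteq> 0" n'] n' by (auto simp: n_def)
  have zero: "d i = 0" if "m \<le> i" "i < n" for i
    using not_less_Least[of i "\<lambda>n. n \<ge> m \<and> d n \<noteq> 0"] that by (auto simp: n_def)
  have "m + L \<le> n"
  proof (rule ccontr)
    assume "\<not> m + L \<le> n"
    hence "n - m < L" using n(1) by linarith
    thus False using m[of "n - m"] n by simp
  qed
  thus ?thesis using that zero n(2) unfolding d_def by blast
qed

section \<open>The orbit modulo 1 along a zero block\<close>

lemma beta_expansion_power_mult: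
  assumes b: "\<beta> > 1" and x: "x \<in> {0..<1}"
  shows "\<beta> ^ n * x = (\<Sum>i<n. real (beta_expansion \<beta> x i) * \<beta> ^ (n - 1 - i)) + (beta_map \<beta> ^^ n) x"
proof (induction n)
  case (Suc n)
  have "\<beta> * (\<Sum>i<n. real (beta_expansion \<beta> x i) * \<beta> ^ (n - 1 - i)) =
      (\<Sum>i<n. real (beta_expansion \<beta> x i) * \<beta> ^ (n - i))"
    unfolding sum_distrib_left
  proof (intro sum.cong refl)
    fix i assume "i \<in> {..<n}"
    hence "n - i = Suc (n - 1 - i)" by auto
    thus "\<beta> * (real (beta_expansion \<beta> x i) * \<beta> ^ (n - 1 - i)) = real (beta_expansion \<beta> x i) * \<beta> ^ (n - i)"
      by simp
  qed
  moreover have "\<beta> ^ Suc n * x = \<beta> * (\<Sum>i<n. real (beta_expansion \<beta> x i) * \<beta> ^ (n - 1 - i))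
      + \<beta> * (beta_map \<beta> ^^ n) x"
    unfolding power_Suc mult.assoc Suc by (simp only: ring_distribs)
  moreover have "(\<Sum>i<Suc n. real (beta_expansion \<beta> x i) * \<beta> ^ (Suc n - 1 - i)) =
      (\<Sum>i<n. real (beta_expansion \<beta> x i) * \<beta> ^ (n - i)) + real (beta_expansion \<beta> x n)"
    by simp
  ultimately show ?case using beta_expansion_step[OF b x, of n] by linarith
qed simp

text \<open>All nonzero terms have index below \<open>m\<close>, so each of them contains the factor \<open>\<rho> ^ (n - m)\<close>; what is left
  is dominated by a geometric series.\<close>

lemma past_sum_le:
  fixes d :: "nat \<Rightarrow> nat" and \<tau> :: "nat \<Rightarrow> real"
  assumes "0 < \<rho>" "\<rho> < 1" and \<tau>: "\<And>k. \<bar>\<tau> k\<bar> \<le> C * \<rho> ^ k" and "0 \<le> C"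
    and d: "\<And>i. real (d i) \<le> D" and "m \<le> n" and z: "\<And>i. m \<le> i \<Longrightarrow> i < n \<Longrightarrow> d i = 0"
  shows "\<bar>\<Sum>i<n. real (d i) * \<tau> (n - 1 - i)\<bar> \<le> D * C / (1 - \<rho>) * \<rho> ^ (n - m)"
proof -
  have D: "0 \<le> D" using d[of 0] by linarith
  have "(\<Sum>i<n. real (d i) * \<tau> (n - 1 - i)) = (\<Sum>i<m. real (d i) * \<tau> (n - 1 - i))"
    using \<open>m \<le> n\<close> z by (intro sum.mono_neutral_right) auto
  also have "\<bar>\<dots>\<bar> \<le> (\<Sum>i<m. D * C * \<rho> ^ (n - m) * \<rho> ^ (m - Suc i))"
  proof (rule order.trans[OF sum_abs sum_mono])
    fix i assume "i \<in> {..<m}"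
    hence e: "n - 1 - i = (n - m) + (m - Suc i)" using \<open>m \<le> n\<close> by auto
    have "\<bar>real (d i) * \<tau> (n - 1 - i)\<bar> \<le> D * (C * \<rho> ^ (n - 1 - i))"
      unfolding abs_mult using d[of i] \<tau>[of "n - 1 - i"] D by (intro mult_mono) auto
    thus "\<bar>real (d i) * \<tau> (n - 1 - i)\<bar> \<le> D * C * \<rho> ^ (n - m) * \<rho> ^ (m - Suc i)"
      unfolding e power_add by (simp add: mult.assoc)
  qed
  also have "\<dots> = D * C * \<rho> ^ (n - m) * (\<Sum>i<m. \<rho> ^ i)"
    unfolding sum_distrib_left[symmetric] by (subst sum.nat_diff_reindex) simp
  also have "\<dots> \<le> D * C * \<rho> ^ (n - m) * (1 / (1 - \<rho>))"
  proof (rule mult_left_mono)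
    show "(\<Sum>i<m. \<rho> ^ i) \<le> 1 / (1 - \<rho>)"
      using assms(1,2) by (simp add: sum_gp_strict divide_right_mono)
  qed (use D assms(1,4) in auto)
  finally show ?thesis by (simp add: mult_ac)
qed

text \<open>The window consists of the indices \<open>n\<close> at distance between \<open>K\<close> and \<open>K + W\<close> before the nonzero digit
  with index \<open>E\<close> that ends a zero block. Distance at least \<open>K\<close> makes \<open>r n\<close> small, distance at most \<open>K + W\<close> keeps
  \<open>r n\<close> above a constant; the block is chosen so long, depending on that constant, that the
  contribution \<open>p n\<close> of the digits before the block is smaller still.\<close>

lemma orbit_near_zero_window:
  fixes W :: nat
  assumes pisot: "pisot_number \<beta>" and \<alpha>: "\<alpha> \<in> {0..<1}" and normal: "normal_to_base \<beta> \<alpha>"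
    and \<epsilon>: "0 < \<epsilon>"
  obtains N where "\<And>n. N < n \<Longrightarrow> n \<le> N + W \<Longrightarrow> frac (\<beta> ^ n * \<alpha>) < \<epsilon>"
proof -
  have b: "\<beta> > 1" using pisot by (simp add: pisot_number_def)
  obtain \<tau> :: "nat \<Rightarrow> real" and C \<rho> :: real where \<rho>: "0 < \<rho>" "\<rho> < 1" and C: "0 \<le> C"
    and \<tau>: "\<And>m. \<bar>\<tau> m\<bar> \<le> C * \<rho> ^ m" and int: "\<And>m. \<beta> ^ m + \<tau> m \<in> \<int>"
    by (rule pisot_near_integer_powers[OF pisot], rule that)
  define d where "d = beta_expansion \<beta> \<alpha>"
  define r where "r n = (beta_map \<beta> ^^ n) \<alpha>" for n
  have r: "0 \<le> r n" "r n < 1" for n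
    using beta_map_iterate_bounds[OF \<alpha>] by (auto simp: r_def)
  have step: "\<beta> * r n = real (d n) + r (Suc n)" for n
    using beta_expansion_step[OF b \<alpha>] by (simp only: r_def d_def)
  have d_le: "real (d n) \<le> \<beta>" for n
    using step[of n] r[of n] r(1)[of "Suc n"] mult_left_mono[of "r n" 1 \<beta>] b by simp
  define p where "p n = (\<Sum>i<n. real (d i) * \<tau> (n - 1 - i))" for n
  define B where "B = \<beta> * C / (1 - \<rho>)"
  have frac_eq_rp: "frac (\<beta> ^ n * \<alpha>) = frac (r n - p n)" for n
  proof -
    have "\<beta> ^ n * \<alpha> = (\<Sum>i<n. real (d i) * \<beta> ^ (n - 1 - i)) + r n"
      using beta_expansion_power_mult[OF b \<alpha>] by (simp only: d_def r_def)
    hence "\<beta> ^ n * \<alpha> = (\<Sum>i<n. real (d i) * (\<beta> ^ (n - 1 - i) + \<tau> (n - 1 - i))) + (r n - p n)"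
      by (simp add: p_def ring_distribs sum.distrib)
    moreover have "(\<Sum>i<n. real (d i) * (\<beta> ^ (n - 1 - i) + \<tau> (n - 1 - i))) \<in> \<int>"
      using int by (intro Ints_sum Ints_mult) auto
    ultimately show ?thesis by (elim Ints_cases) (simp add: frac_def)
  qed
  \<comment> \<open>Half of \<open>\<epsilon>\<close> bounds \<open>r n\<close>, the other half bounds \<open>p n\<close>; below 1 no wrap-around occurs.\<close>
  obtain K where K: "(1 / \<beta>) ^ K < min \<epsilon> 1 / 2"
    using real_arch_pow_inv[of "min \<epsilon> 1 / 2" "1 / \<beta>"] \<epsilon> b by auto
  have "(\<lambda>j. B * \<rho> ^ j) \<longlonglongrightarrow> B * 0"
    using \<rho> by (intro tendsto_mult tendsto_const LIMSEQ_power_zero) auto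
  hence "\<forall>\<^sub>F j in sequentially. B * \<rho> ^ j < 1 / \<beta> ^ (K + W + 1)"
    using b by (intro order_tendstoD(2)) auto
  then obtain j where j: "B * \<rho> ^ j < 1 / \<beta> ^ (K + W + 1)"
    by (auto simp: eventually_sequentially)
  \<comment> \<open>At least \<open>j\<close> zeros of the block precede the window.\<close>
  obtain m E where mE: "m + (j + K + W) \<le> E"
    and zero: "\<And>i. m \<le> i \<Longrightarrow> i < E \<Longrightarrow> d i = 0" and dE: "d E \<noteq> 0"
    using normal_long_zero_run[OF b \<alpha> normal] unfolding d_def by metis
  have rE: "1 / \<beta> \<le> r E"
    using step[of E] r(1)[of "Suc E"] dE b by (simp add: field_simps)
  show ?thesis
  proof (rule that[of "E - K - W"])
    fix n assume n: "E - K - W < n" "n \<le> E - K - W + W"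
    define k where "k = E - n"
    have k: "K \<le> k" "k \<le> K + W" "n = E - k" "n \<le> E" "m \<le> n" "j \<le> n - m"
      using n mE by (auto simp: k_def)
    have "r E = \<beta> ^ k * r n"
      using beta_map_iterate_zero_run[OF b \<alpha> \<open>n \<le> E\<close>] zero k(5) unfolding r_def d_def k_def by auto
    hence rn: "r n = r E / \<beta> ^ k" using b by simp
    have "\<bar>p n\<bar> \<le> B * \<rho> ^ (n - m)"
      unfolding p_def B_def
      using \<rho> \<tau> C d_le k(4,5) zero by (intro past_sum_le) auto
    also have "\<dots> \<le> B * \<rho> ^ j"
      using k(6) \<rho> C b by (intro mult_left_mono power_decreasing) (auto simp: B_def)
    also have "\<dots> < 1 / \<beta> ^ (K + W + 1)" by (rule j)
    also have "\<dots> \<le> 1 / \<beta> ^ (k + 1)"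
      using k(2) b by (intro divide_left_mono power_increasing) auto
    finally have pn: "\<bar>p n\<bar> < 1 / \<beta> ^ (k + 1)" .
    have lower: "1 / \<beta> ^ (k + 1) \<le> r n"
      unfolding rn using divide_right_mono[OF rE, of "\<beta> ^ k"] b by (simp add: mult.commute)
    have "r n \<le> 1 / \<beta> ^ k" unfolding rn using r(2)[of E] b by (simp add: divide_right_mono)
    moreover have "1 / \<beta> ^ (k + 1) \<le> 1 / \<beta> ^ k"
      using b by (intro divide_left_mono power_increasing) auto
    moreover have "1 / \<beta> ^ k \<le> 1 / \<beta> ^ K"
      using b k(1) by (intro divide_left_mono power_increasing) auto
    moreover have "1 / \<beta> ^ K < min \<epsilon> 1 / 2" using K by (simp add: power_one_over)
    ultimately have "r n - p n < min \<epsilon> 1" using pn by linarith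
    moreover have "0 \<le> r n - p n" using lower pn by linarith
    ultimately have "frac (r n - p n) = r n - p n" "r n - p n < \<epsilon>" by (auto simp: frac_eq)
    thus "frac (\<beta> ^ n * \<alpha>) < \<epsilon>" unfolding frac_eq_rp by simp
  qed
qed

section \<open>No bounded remainder sets\<close>

lemma bounded_remainder_set_window:
  assumes "bounded_remainder_set x a b"
  obtains c where "\<And>N W. \<bar>real (card {n \<in> {N<..N + W}. x n \<in> {a..<b}}) - real W * (b - a)\<bar> \<le> c"
proof -
  obtain c where c: "\<And>N. N \<ge> 1 \<Longrightarrow> \<bar>discrepancy x a b N\<bar> \<le> c * (1 / real N)"
    using assms by (auto simp: bounded_remainder_set_def)
  define f where "f N = real (card {n \<in> {1..N}. x n \<in> {a..<b}}) - real N * (b - a)" for N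
  have "\<bar>f N\<bar> \<le> c" if "N \<ge> 1" for N
  proof -
    have "discrepancy x a b N = f N / real N" by (simp add: discrepancy_def f_def)
    hence "\<bar>f N\<bar> / real N \<le> c / real N" using c[OF that] by simp
    thus ?thesis using that by (simp add: divide_le_cancel)
  qed
  moreover have "f 0 = 0" by (simp add: f_def)
  ultimately have f: "\<bar>f N\<bar> \<le> \<bar>c\<bar>" for N
    by (cases "N = 0") (simp, metis One_nat_def Suc_leI abs_ge_self neq0_conv order.trans)
  show ?thesis
  proof (rule that[of "2 * \<bar>c\<bar>"])
    fix N W :: nat
    have split: "{1..N + W} = {1..N} \<union> {N<..N + W}" by auto
    have disj: "{n \<in> {1..N}. x n \<in> {a..<b}} \<inter> {n \<in> {N<..N + W}. x n \<in> {a..<b}} = {}"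
      by (simp add: disjoint_iff)
    have "{n \<in> {1..N + W}. x n \<in> {a..<b}} =
        {n \<in> {1..N}. x n \<in> {a..<b}} \<union> {n \<in> {N<..N + W}. x n \<in> {a..<b}}"
      unfolding split by blast
    hence "card {n \<in> {1..N + W}. x n \<in> {a..<b}} =
        card {n \<in> {1..N}. x n \<in> {a..<b}} + card {n \<in> {N<..N + W}. x n \<in> {a..<b}}"
      using card_Un_disjoint[OF _ _ disj] by simp
    hence "real (card {n \<in> {N<..N + W}. x n \<in> {a..<b}}) - real W * (b - a) = f (N + W) - f N"
      by (simp add: f_def algebra_simps)
    thus "\<bar>real (card {n \<in> {N<..N + W}. x n \<in> {a..<b}}) - real W * (b - a)\<bar> \<le> 2 * \<bar>c\<bar>"
      using f[of N] f[of "N + W"] by linarith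
  qed
qed

theorem theorem1:
  fixes \<beta> \<alpha> :: real
  assumes "pisot_number \<beta>"
    and "\<alpha> \<in> {0..<1}"
    and "normal_to_base \<beta> \<alpha>"
  shows "\<forall>a b. {a..<b} \<subseteq> {0..<1} \<and> {a..<b} \<noteq> {} \<and> {a..<b} \<noteq> {0..<1} \<longrightarrow>
           \<not> bounded_remainder_set (\<lambda>n. frac (\<beta> ^ n * \<alpha>)) a b"
proof (intro allI impI notI, elim conjE)
  fix a b :: real
  assume sub: "{a..<b} \<subseteq> {0..<1}" and "{a..<b} \<noteq> {}" and nontriv: "{a..<b} \<noteq> {0..<1}"
    and brs: "bounded_remainder_set (\<lambda>n. frac (\<beta> ^ n * \<alpha>)) a b"
  hence ab: "a < b" by simp
  have a0: "0 \<le> a" and b1: "b \<le> 1"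
    using atLeastLessThan_subset_iff[OF sub] ab by auto
  obtain c where c: "\<And>N W. \<bar>real (card {n \<in> {N<..N + W}. frac (\<beta> ^ n * \<alpha>) \<in> {a..<b}})
      - real W * (b - a)\<bar> \<le> c"
    using bounded_remainder_set_window[OF brs] by blast
  show False
  proof (cases "a = 0")
    case True
    hence "0 < 1 - b" using b1 nontriv by fastforce
    then obtain W :: nat where W: "c < real W * (1 - b)" using reals_Archimedean3 by blast
    obtain N where N: "\<And>n. N < n \<Longrightarrow> n \<le> N + W \<Longrightarrow> frac (\<beta> ^ n * \<alpha>) < b"
      using orbit_near_zero_window[OF assms, of b W] ab True by blast
    have "{n \<in> {N<..N + W}. frac (\<beta> ^ n * \<alpha>) \<in> {a..<b}} = {N<..N + W}"
      using N True by auto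
    hence "\<bar>real W - real W * b\<bar> \<le> c" using c[of N W] True by simp
    thus False using W by (simp add: algebra_simps)
  next
    case False
    hence "0 < a" using a0 by simp
    obtain W :: nat where W: "c < real W * (b - a)" using reals_Archimedean3[of "b - a"] ab by auto
    obtain N where N: "\<And>n. N < n \<Longrightarrow> n \<le> N + W \<Longrightarrow> frac (\<beta> ^ n * \<alpha>) < a"
      using orbit_near_zero_window[OF assms \<open>0 < a\<close>, of W] by blast
    have "{n \<in> {N<..N + W}. frac (\<beta> ^ n * \<alpha>) \<in> {a..<b}} = {}"
      using N by fastforce
    hence "\<bar>0 - real W * (b - a)\<bar> \<le> c" using c[of N W] by (simp only: card.empty of_nat_0)
    thus False using W by linarith
  qed
qed

end
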